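(* Let $G$ be a finite simple graph with $m:=|E(G)|$ and maximum degree $\Delta(G)\le \frac{m}{4350}$. Then $$\mathrm{tes}(G)=\left\lceil\frac{m+2}{3}\right\rceil.$$
   Context: Graphs are finite and simple. For a graph $G=(V,E)$ and a positive integer $s$, an edge irregular total $s$-weighting is a map $\hat w:E\cup V\to\{1,2,\ldots,s\}$ such that $\hat w(uv)+\hat w(u)+\hat w(v)\ne \hat w(u'v')+\hat w(u')+\hat w(v')$ whenever $uv\neq u'v'$ are two different edges of $G$. The total edge irregularity strength $\mathrm{tes}(G)$ is the minimum $s$ for which there exists an edge irregular total $s$-weighting of $G$. *)

theory Defs
  imports Complex_Main
begin

text \<open>Edges are two-element sets of vertices, so loops and parallel edges are excluded.\<close>

definition fin_simple_graph :: "'a set \<Rightarrow> 'a set set \<Rightarrow> bool" where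
  "fin_simple_graph V E \<longleftrightarrow> finite V \<and> (\<forall>e\<in>E. e \<subseteq> V \<and> card e = 2)"

definition vertex_degree :: "'a set set \<Rightarrow> 'a \<Rightarrow> nat" where
  "vertex_degree E v = card {e \<in> E. v \<in> e}"

text \<open>Inserting 0 only matters for the graph without vertices, whose maximum degree is 0.\<close>

definition max_degree :: "'a set \<Rightarrow> 'a set set \<Rightarrow> nat" where
  "max_degree V E = Max (insert 0 (vertex_degree E ` V))"

text \<open>
  A total weighting lives on the disjoint union of \<open>V\<close> and \<open>E\<close>:
  \<open>Inl v\<close> stands for the vertex \<open>v\<close> and \<open>Inr e\<close> for the edge \<open>e\<close>.
  Values outside \<open>V <+> E\<close> are irrelevant.
\<close>

definition total_edge_weight :: "('a + 'a set \<Rightarrow> nat) \<Rightarrow> 'a set \<Rightarrow> nat" where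
  "total_edge_weight w e = w (Inr e) + (\<Sum>v\<in>e. w (Inl v))"

definition edge_irregular_total_weighting ::
    "'a set \<Rightarrow> 'a set set \<Rightarrow> nat \<Rightarrow> ('a + 'a set \<Rightarrow> nat) \<Rightarrow> bool" where
  "edge_irregular_total_weighting V E s w \<longleftrightarrow>
     (\<forall>x \<in> V <+> E. w x \<in> {1..s}) \<and>
     (\<forall>e\<in>E. \<forall>e'\<in>E. e \<noteq> e' \<longrightarrow> total_edge_weight w e \<noteq> total_edge_weight w e')"

definition tes :: "'a set \<Rightarrow> 'a set set \<Rightarrow> nat" where
  "tes V E = (LEAST s. s \<ge> 1 \<and> (\<exists>w. edge_irregular_total_weighting V E s w))"

text \<open>The set over which the minimum is taken is never empty.\<close>

lemma edge_irregular_total_weighting_exists: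
  assumes "fin_simple_graph V E"
  shows "\<exists>s\<ge>1. \<exists>w. edge_irregular_total_weighting V E s w"
proof -
  have fV: "finite V" and E: "\<And>e. e \<in> E \<Longrightarrow> e \<subseteq> V \<and> card e = 2"
    using assms by (auto simp: fin_simple_graph_def)
  have "finite E"
    using fV E by (meson Pow_iff finite_Pow_iff finite_subset subsetI)
  then obtain f :: "'a set \<Rightarrow> nat" where f: "inj_on f E"
    using finite_imp_inj_to_nat_seg by blast
  define w :: "'a + 'a set \<Rightarrow> nat" where "w = case_sum (\<lambda>_. 1) (\<lambda>e. Suc (f e))"
  define s where "s = Suc (Max (insert 0 (f ` E)))"
  have "f e \<le> Max (insert 0 (f ` E))" if "e \<in> E" for e
    using that \<open>finite E\<close> by (intro Max_ge) auto
  then have "\<forall>x \<in> V <+> E. w x \<in> {1..s}"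
    by (auto simp: w_def s_def)
  moreover have "total_edge_weight w e = f e + 3" if "e \<in> E" for e
    using E[OF that] by (simp add: total_edge_weight_def w_def)
  then have "total_edge_weight w e \<noteq> total_edge_weight w e'"
    if "e \<in> E" "e' \<in> E" "e \<noteq> e'" for e e'
    using that f by (auto dest: inj_onD)
  ultimately have "edge_irregular_total_weighting V E s w"
    unfolding edge_irregular_total_weighting_def by blast
  then show ?thesis
    unfolding s_def by (metis One_nat_def Suc_le_mono le0)
qed

end

theory Submission
  imports Defs "HOL-Library.FuncSet"
begin

text \<open>
  Shift all weights to start at 0, so that with \<open>s = \<lceil>(m - 1) / 3\<rceil>\<close> the edges need distinct totals.
  Give the vertices independent random labels in \<open>{0..7}\<close>, the extreme labels having
  probability 1/3 each, and let label \<open>i\<close> stand for the vertex weight \<open>\<lfloor>i s / 7\<rfloor>\<close>.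
  Rank the edges by label sum and use the rank of an edge as its total. This is possible as soon as
  the rank exceeds the sum of the two vertex weights by at least 0 and at most \<open>s\<close>, which only
  constrains, for each \<open>j < 14\<close>, the number of edges with label sum at most \<open>j\<close>.
  The indicators of disjoint edges are independent, so this number has variance at most
  \<open>m \<Delta> / 2 \<le> m\<^sup>2 / 8700\<close>, and Chebyshev's inequality with a union bound over \<open>j\<close> yields a
  suitable labelling.
\<close>

section \<open>Random vertex labels\<close>

locale random_labelling =
  fixes V :: "'a set" and I :: "'i set" and P :: "'i \<Rightarrow> real"
  assumes finite_V: "finite V" and finite_I: "finite I"
    and P_nonneg: "\<And>i. P i \<ge> 0" and sum_P: "(\<Sum>i\<in>I. P i) = 1"
begin

text \<open>Expectation under the product distribution, in which the labels \<open>f v\<close> are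
  independent with law \<open>P\<close>; since \<open>V\<close> and \<open>I\<close> are finite, it
  is a weighted finite sum.\<close>

definition expect :: "(('a \<Rightarrow> 'i) \<Rightarrow> real) \<Rightarrow> real" where
  "expect X = (\<Sum>f \<in> V \<rightarrow>\<^sub>E I. (\<Prod>v\<in>V. P (f v)) * X f)"

text \<open>Independence of distinct vertices: pad the product with factors 1 outside
  \<open>W\<close> and exchange product and sum; every padded vertex then contributes the total mass
  1.\<close>

lemma expect_prod:
  assumes "W \<subseteq> V"
  shows "expect (\<lambda>f. \<Prod>v\<in>W. g v (f v)) = (\<Prod>v\<in>W. \<Sum>i\<in>I. P i * g v i)"
proof -
  have "(\<Prod>v\<in>V. P (f v)) * (\<Prod>v\<in>W. g v (f v)) =
      (\<Prod>v\<in>V. P (f v) * (if v \<in> W then g v (f v) else 1))" for f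
    using assms finite_V by (simp add: prod.distrib prod.If_cases Int_absorb1)
  then have "expect (\<lambda>f. \<Prod>v\<in>W. g v (f v)) =
      (\<Prod>v\<in>V. \<Sum>i\<in>I. P i * (if v \<in> W then g v i else 1))"
    unfolding expect_def using finite_V finite_I by (simp add: prod_sum_PiE)
  also have "\<dots> = (\<Prod>v\<in>V. if v \<in> W then \<Sum>i\<in>I. P i * g v i else 1)"
    using sum_P by (intro prod.cong) auto
  also have "\<dots> = (\<Prod>v\<in>W. \<Sum>i\<in>I. P i * g v i)"
    using assms finite_V by (simp add: prod.If_cases Int_absorb1)
  finally show ?thesis .
qed

lemma expect_const: "expect (\<lambda>_. c) = c"
  using expect_prod[of "{}"] by (simp add: expect_def flip: sum_distrib_right)

lemma expect_sum: "expect (\<lambda>f. \<Sum>x\<in>A. X x f) = (\<Sum>x\<in>A. expect (X x))"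
  unfolding expect_def sum_distrib_left by (rule sum.swap)

lemma expect_add: "expect (\<lambda>f. X f + Y f) = expect X + expect Y"
  unfolding expect_def by (simp add: algebra_simps sum.distrib)

lemma expect_cmult: "expect (\<lambda>f. c * X f) = c * expect X"
  unfolding expect_def sum_distrib_left by (simp add: algebra_simps)

lemma expect_cong:
  assumes "\<And>f. f \<in> V \<rightarrow>\<^sub>E I \<Longrightarrow> X f = Y f"
  shows "expect X = expect Y"
  unfolding expect_def using assms by simp

lemma expect_mono:
  assumes "\<And>f. f \<in> V \<rightarrow>\<^sub>E I \<Longrightarrow> X f \<le> Y f"
  shows "expect X \<le> expect Y"
  unfolding expect_def
  by (intro sum_mono mult_left_mono assms prod_nonneg) (simp_all add: P_nonneg)

text \<open>First moment method: if \<open>X\<close> were at least \<open>c\<close> everywhere,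
  monotonicity would bound its expectation below by \<open>c\<close>.\<close>

lemma ex_less_of_expect_less:
  assumes "expect X < c"
  shows "\<exists>f \<in> V \<rightarrow>\<^sub>E I. X f < c"
proof (rule ccontr)
  assume "\<not> ?thesis"
  then have "expect (\<lambda>_. c) \<le> expect X"
    by (intro expect_mono) auto
  with assms show False by (simp add: expect_const)
qed

definition pair_expect :: "('i \<Rightarrow> 'i \<Rightarrow> real) \<Rightarrow> real" where
  "pair_expect q = (\<Sum>a\<in>I. \<Sum>b\<in>I. P a * P b * q a b)"

lemma pair_expect_altdef: "pair_expect q = (\<Sum>a\<in>I. P a * (\<Sum>b\<in>I. P b * q a b))"
  by (simp add: pair_expect_def sum_distrib_left mult.assoc)

text \<open>Splits \<open>q\<close> by the value of its first argument. Each summand is a product of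
  functions of one argument, the shape that \<open>expect_prod\<close> handles.\<close>

lemma sum_delta_first:
  assumes "x \<in> I"
  shows "q x y = (\<Sum>a\<in>I. of_bool (x = a) * (q a y :: real))"
  using assms finite_I by (simp add: of_bool_def if_distrib[of "\<lambda>c. c * _"] cong: if_cong)

lemma sum_P_delta: "a \<in> I \<Longrightarrow> (\<Sum>i\<in>I. P i * of_bool (i = a)) = P a"
  using finite_I by (simp add: of_bool_def if_distrib cong: if_cong)

lemma expect_pair:
  assumes "u \<in> V" "v \<in> V" "u \<noteq> v"
  shows "expect (\<lambda>f. q (f u) (f v)) = pair_expect q"
proof -
  have "expect (\<lambda>f. of_bool (f u = a) * q a (f v)) = P a * (\<Sum>b\<in>I. P b * q a b)"
    if "a \<in> I" for a
    using expect_prod[of "{u,v}" "\<lambda>x i. if x = u then of_bool (i = a) else q a i"] that assms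
    by (simp add: sum_P_delta)
  moreover have "expect (\<lambda>f. q (f u) (f v)) =
      expect (\<lambda>f. \<Sum>a\<in>I. of_bool (f u = a) * q a (f v))"
    using assms by (intro expect_cong sum_delta_first) auto
  ultimately show ?thesis
    by (simp add: expect_sum pair_expect_altdef)
qed

text \<open>Disjoint edges carry independent labels. Splitting \<open>q\<close> and \<open>r\<close>
  by the values at \<open>u\<close> and \<open>u'\<close> leaves products of four single-vertex
  factors.\<close>

lemma expect_two_pairs:
  assumes "u \<in> V" "v \<in> V" "u \<noteq> v" "u' \<in> V" "v' \<in> V" "u' \<noteq> v'" "{u,v} \<inter> {u',v'} = {}"
  shows "expect (\<lambda>f. q (f u) (f v) * r (f u') (f v')) = pair_expect q * pair_expect r"
proof -
  have dist: "u \<noteq> u'" "u' \<noteq> u" "u \<noteq> v'" "v' \<noteq> u" "v \<noteq> u'" "u' \<noteq> v" "v \<noteq> v'" "v' \<noteq> v"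
      "v \<noteq> u" "v' \<noteq> u'" "u \<noteq> v" "u' \<noteq> v'"
    using assms(3,6,7) by blast+
  have *: "expect (\<lambda>f. of_bool (f u = a) * q a (f v) * (of_bool (f u' = c) * r c (f v'))) =
      (P a * (\<Sum>b\<in>I. P b * q a b)) * (P c * (\<Sum>b\<in>I. P b * r c b))"
    if "a \<in> I" "c \<in> I" for a c
  proof -
    define g where "g = (\<lambda>x i. if x = u then of_bool (i = a) else if x = v then q a i
       else if x = u' then of_bool (i = c) else r c i)"
    have g: "g u = (\<lambda>i. of_bool (i = a))" "g v = q a" "g u' = (\<lambda>i. of_bool (i = c))" "g v' = r c"
      using dist by (simp_all add: g_def)
    have prod4: "(\<Prod>x\<in>{u,v,u',v'}. G x) = G u * G v * (G u' * G v')" for G :: "'a \<Rightarrow> real"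
      using dist by (simp add: mult.assoc)
    have "{u,v,u',v'} \<subseteq> V" using assms by simp
    from expect_prod[OF this, of g] show ?thesis
      unfolding prod4 g by (simp only: sum_P_delta that)
  qed
  have "expect (\<lambda>f. q (f u) (f v) * r (f u') (f v')) =
      expect (\<lambda>f. \<Sum>a\<in>I. \<Sum>c\<in>I. of_bool (f u = a) * q a (f v) * (of_bool (f u' = c) * r c (f v')))"
  proof (rule expect_cong)
    fix f assume f: "f \<in> V \<rightarrow>\<^sub>E I"
    then have "f u \<in> I" "f u' \<in> I" using assms by auto
    then show "q (f u) (f v) * r (f u') (f v') =
      (\<Sum>a\<in>I. \<Sum>c\<in>I. of_bool (f u = a) * q a (f v) * (of_bool (f u' = c) * r c (f v')))"
      unfolding sum_product[symmetric] by (simp only: sum_delta_first[symmetric])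
  qed
  also have "\<dots> = pair_expect q * pair_expect r"
    by (simp add: expect_sum * pair_expect_altdef sum_product)
  finally show ?thesis .
qed

end

section \<open>Vertex degrees and incident edges\<close>

lemma vertex_degree_le_max_degree:
  assumes "finite V" "v \<in> V"
  shows "vertex_degree E v \<le> max_degree V E"
  unfolding max_degree_def using assms by (intro Max_ge) auto

lemma fin_simple_graph_finite_edges:
  assumes "fin_simple_graph V E"
  shows "finite E"
  by (rule finite_subset[of E "Pow V"]) (use assms in \<open>auto simp: fin_simple_graph_def\<close>)

lemma fin_simple_graph_edgeE:
  assumes "fin_simple_graph V E" "e \<in> E"
  obtains u v where "e = {u, v}" "u \<noteq> v" "u \<in> V" "v \<in> V"
proof -
  have "e \<subseteq> V" "card e = 2" using assms by (auto simp: fin_simple_graph_def)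
  moreover from this obtain u v where "e = {u, v}" "u \<noteq> v" unfolding card_2_iff by blast
  ultimately show thesis using that by simp
qed

lemma card_incident_edges_le:
  assumes G: "fin_simple_graph V E" and e: "e \<in> E"
  shows "card {e' \<in> E. e \<inter> e' \<noteq> {}} \<le> 2 * max_degree V E"
proof -
  obtain u v where uv: "e = {u, v}" "u \<noteq> v" "u \<in> V" "v \<in> V"
    using fin_simple_graph_edgeE[OF G e] .
  have "{e' \<in> E. e \<inter> e' \<noteq> {}} = {e' \<in> E. u \<in> e'} \<union> {e' \<in> E. v \<in> e'}"
    using uv by auto
  then have "card {e' \<in> E. e \<inter> e' \<noteq> {}} \<le> vertex_degree E u + vertex_degree E v"
    unfolding vertex_degree_def by (simp add: card_Un_le)
  also have "\<dots> \<le> 2 * max_degree V E"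
    using vertex_degree_le_max_degree[of V u E] vertex_degree_le_max_degree[of V v E] G uv
    by (simp add: fin_simple_graph_def)
  finally show ?thesis .
qed

section \<open>Variance and concentration of the label counts\<close>

definition label_count :: "'a set set \<Rightarrow> ('a \<Rightarrow> nat) \<Rightarrow> nat \<Rightarrow> nat" where
  "label_count E f j = card {e \<in> E. (\<Sum>v\<in>e. f v) \<le> j}"

context random_labelling
begin

text \<open>Expand the variance into covariances of edge indicators. Disjoint edges contribute 0,
  any other pair at most 1/4, and an edge meets at most \<open>2 * max_degree V E\<close> edges,
  itself included.\<close>

lemma edge_indicator_sum_variance:
  assumes G: "fin_simple_graph V E"
    and q: "\<And>a b. q a b \<in> {0, 1}"
    and X: "\<And>u v f. u \<in> V \<Longrightarrow> v \<in> V \<Longrightarrow> u \<noteq> v \<Longrightarrow> X {u, v} f = q (f u) (f v)"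
  shows "expect (\<lambda>f. ((\<Sum>e\<in>E. X e f) - real (card E) * pair_expect q)\<^sup>2)
      \<le> real (card E) * real (max_degree V E) / 2"
proof -
  define \<mu> where "\<mu> = pair_expect q"
  have fE: "finite E" using G by (rule fin_simple_graph_finite_edges)
  have EX: "expect (X e) = \<mu>" and X01: "X e f \<in> {0, 1}" if e: "e \<in> E" for e f
  proof -
    obtain u v where uv: "e = {u, v}" "u \<noteq> v" "u \<in> V" "v \<in> V"
      using fin_simple_graph_edgeE[OF G e] .
    have Xe: "X e = (\<lambda>f. q (f u) (f v))" unfolding uv(1) using X[OF uv(3,4,2)] by (rule ext)
    show "expect (X e) = \<mu>" unfolding Xe \<mu>_def using uv by (intro expect_pair)
    show "X e f \<in> {0, 1}" unfolding Xe by (rule q)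
  qed
  define C where "C e e' = expect (\<lambda>f. X e f * X e' f) - \<mu>\<^sup>2" for e e'
  have cov: "expect (\<lambda>f. (X e f - \<mu>) * (X e' f - \<mu>)) = C e e'"
    if "e \<in> E" "e' \<in> E" for e e'
  proof -
    have "expect (\<lambda>f. (X e f - \<mu>) * (X e' f - \<mu>)) =
        expect (\<lambda>f. X e f * X e' f + ((- \<mu>) * X e f + ((- \<mu>) * X e' f + \<mu>\<^sup>2)))"
      by (simp add: algebra_simps power2_eq_square)
    also have "\<dots> = C e e'"
      unfolding expect_add expect_cmult expect_const
      using that by (simp add: C_def EX power2_eq_square)
    finally show ?thesis .
  qed
  have C0: "C e e' = 0" if e: "e \<in> E" and e': "e' \<in> E" and disj: "e \<inter> e' = {}" for e e'
  proof -
    obtain u v where uv: "e = {u, v}" "u \<noteq> v" "u \<in> V" "v \<in> V"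
      using fin_simple_graph_edgeE[OF G e] .
    obtain u' v' where uv': "e' = {u', v'}" "u' \<noteq> v'" "u' \<in> V" "v' \<in> V"
      using fin_simple_graph_edgeE[OF G e'] .
    show ?thesis
      using expect_two_pairs[of u v u' v' q q] uv uv' disj X
      by (simp add: C_def \<mu>_def power2_eq_square)
  qed
  have C1: "C e e' \<le> 1 / 4" if "e \<in> E" "e' \<in> E" for e e'
  proof -
    \<comment> \<open>A product of 0/1 values is at most either factor, which bounds the covariance
      by the variance \<open>\<mu> - \<mu>\<^sup>2\<close> of a single indicator.\<close>
    have "expect (\<lambda>f. X e f * X e' f) \<le> expect (X e)"
    proof (rule expect_mono)
      fix f
      show "X e f * X e' f \<le> X e f" using X01[OF that(1), of f] X01[OF that(2), of f] by auto
    qed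
    then have "C e e' \<le> \<mu> - \<mu>\<^sup>2" by (simp add: C_def EX that)
    also have "\<dots> \<le> 1 / 4"
      using zero_le_power2[of "\<mu> - 1 / 2"] by (simp add: power2_eq_square algebra_simps)
    finally show ?thesis .
  qed
  have "expect (\<lambda>f. ((\<Sum>e\<in>E. X e f) - real (card E) * \<mu>)\<^sup>2) =
      expect (\<lambda>f. \<Sum>e\<in>E. \<Sum>e'\<in>E. (X e f - \<mu>) * (X e' f - \<mu>))"
    by (simp add: sum_subtractf power2_eq_square flip: sum_product)
  also have "\<dots> = (\<Sum>e\<in>E. \<Sum>e'\<in>E. C e e')"
    by (simp add: expect_sum cov)
  also have "\<dots> = (\<Sum>e\<in>E. \<Sum>e'\<in>{e'\<in>E. e \<inter> e' \<noteq> {}}. C e e')"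
    using fE C0 by (intro sum.cong refl sum.mono_neutral_right) auto
  also have "\<dots> \<le> (\<Sum>e\<in>E. real (card {e'\<in>E. e \<inter> e' \<noteq> {}}) * (1 / 4))"
    using C1 by (intro sum_mono sum_bounded_above) auto
  also have "\<dots> \<le> (\<Sum>e\<in>E. real (2 * max_degree V E) * (1 / 4))"
    using card_incident_edges_le[OF G] by (intro sum_mono mult_right_mono) (auto simp only: of_nat_le_iff)
  finally show ?thesis by (simp add: \<mu>_def)
qed

end

text \<open>Chebyshev's inequality and the union bound in one step: the sum over \<open>j\<close> of
  the squared deviations, each divided by its squared threshold, has expectation below 1. Some
  labelling keeps this sum below 1, and hence every summand.\<close>

lemma ex_concentrated_labelling:
  fixes I :: "nat set"
  assumes G: "fin_simple_graph V E" and E: "E \<noteq> {}"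
    and rl: "random_labelling V I P"
    and K: "K > 0" "real (max_degree V E) * K \<le> real (card E)"
    and \<theta>: "\<And>j. j < n \<Longrightarrow> \<theta> j > 0" "(\<Sum>j<n. 1 / (\<theta> j)\<^sup>2) < 2 * K"
  shows "\<exists>f \<in> V \<rightarrow>\<^sub>E I. \<forall>j<n.
    \<bar>real (label_count E f j) -
      real (card E) * random_labelling.pair_expect I P (\<lambda>a b. of_bool (a + b \<le> j))\<bar>
    < \<theta> j * real (card E)"
proof -
  interpret random_labelling V I P by (rule rl)
  define m where "m = real (card E)"
  define \<mu> where "\<mu> j = pair_expect (\<lambda>a b. of_bool (a + b \<le> j))" for j
  define D where "D j f = real (label_count E f j) - m * \<mu> j" for j f
  have fE: "finite E" using G by (rule fin_simple_graph_finite_edges)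
  have m: "m > 0" using fE E by (simp add: m_def card_gt_0_iff)
  have var: "expect (\<lambda>f. (D j f)\<^sup>2) \<le> m\<^sup>2 / (2 * K)" for j
  proof -
    have *: "real (label_count E f j) = (\<Sum>e\<in>E. of_bool ((\<Sum>v\<in>e. f v) \<le> j))" for f
      using fE by (simp add: label_count_def Int_def)
    have "expect (\<lambda>f. (D j f)\<^sup>2) \<le> m * real (max_degree V E) / 2"
      unfolding D_def * m_def \<mu>_def by (rule edge_indicator_sum_variance[OF G]) auto
    also have "\<dots> \<le> m\<^sup>2 / (2 * K)"
      using K m mult_left_mono[OF K(2), of m] by (simp add: m_def field_simps power2_eq_square)
    finally show ?thesis .
  qed
  have "expect (\<lambda>f. \<Sum>j<n. 1 / (\<theta> j * m)\<^sup>2 * (D j f)\<^sup>2) =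
      (\<Sum>j<n. 1 / (\<theta> j * m)\<^sup>2 * expect (\<lambda>f. (D j f)\<^sup>2))"
    unfolding expect_sum expect_cmult ..
  also have "\<dots> \<le> (\<Sum>j<n. 1 / (\<theta> j * m)\<^sup>2 * (m\<^sup>2 / (2 * K)))"
    by (intro sum_mono mult_left_mono var) simp
  also have "\<dots> = (\<Sum>j<n. 1 / (\<theta> j)\<^sup>2) / (2 * K)"
    using m by (simp add: sum_divide_distrib power_mult_distrib)
  also have "\<dots> < 1" using \<theta>(2) K(1) by simp
  finally obtain f where f: "f \<in> V \<rightarrow>\<^sub>E I"
      and less: "(\<Sum>j<n. 1 / (\<theta> j * m)\<^sup>2 * (D j f)\<^sup>2) < 1"
    using ex_less_of_expect_less by blast
  have "\<bar>D j f\<bar> < \<theta> j * m" if j: "j < n" for j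
  proof -
    have "1 / (\<theta> j * m)\<^sup>2 * (D j f)\<^sup>2 \<le> (\<Sum>j<n. 1 / (\<theta> j * m)\<^sup>2 * (D j f)\<^sup>2)"
      using j by (intro member_le_sum) auto
    with less have "1 / (\<theta> j * m)\<^sup>2 * (D j f)\<^sup>2 < 1" by simp
    then have "(D j f)\<^sup>2 < (\<theta> j * m)\<^sup>2"
      using \<theta>(1)[OF j] m by (simp add: field_simps)
    then have "\<bar>D j f\<bar> < \<bar>\<theta> j * m\<bar>"
      using abs_le_square_iff[of "\<theta> j * m" "D j f"] by (metis not_le)
    then show ?thesis using \<theta>(1)[OF j] m by simp
  qed
  then show ?thesis using f unfolding D_def \<mu>_def m_def by blast
qed

section \<open>From vertex labels to weightings\<close>

lemma ex_rank:
  fixes k :: "'b \<Rightarrow> nat"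
  assumes "finite E"
  shows "\<exists>\<rho>. inj_on \<rho> E \<and>
    (\<forall>e\<in>E. card {e' \<in> E. k e' < k e} \<le> \<rho> e \<and> \<rho> e < card {e' \<in> E. k e' \<le> k e})"
proof -
  obtain g :: "'b \<Rightarrow> nat" and n where g: "g ` E = {i. i < n}" "inj_on g E"
    using finite_imp_inj_to_nat_seg[OF assms] by blast
  have gn: "g e < n" if "e \<in> E" for e using g(1) that by auto
  \<comment> \<open>Lexicographic code: as \<open>g e < n\<close> on \<open>E\<close>, the key
    \<open>k\<close> decides first and \<open>g\<close> only breaks ties.\<close>
  define h where "h e = k e * n + g e" for e
  have h_mono: "h e < h e'" if "e \<in> E" "k e < k e'" for e e'
  proof -
    have "h e < Suc (k e) * n" using gn[OF that(1)] by (simp add: h_def)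
    also have "\<dots> \<le> k e' * n" using that(2) by (intro mult_le_mono1) simp
    finally show ?thesis by (simp add: h_def)
  qed
  have h_inj: "e = e'" if "e \<in> E" "e' \<in> E" "h e = h e'" for e e'
  proof -
    have "k e = k e'" using h_mono[of e e'] h_mono[of e' e] that by force
    then show ?thesis using that g(2) by (auto simp: h_def dest: inj_onD)
  qed
  define \<rho> where "\<rho> e = card {e' \<in> E. h e' < h e}" for e
  have mono: "\<rho> e < \<rho> e'" if "e \<in> E" "h e < h e'" for e e'
    unfolding \<rho>_def using assms that by (intro psubset_card_mono) auto
  have "inj_on \<rho> E"
  proof (rule inj_onI)
    fix e e' assume "e \<in> E" "e' \<in> E" "\<rho> e = \<rho> e'"
    then show "e = e'" using mono[of e e'] mono[of e' e] h_inj[of e e'] by linarith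
  qed
  moreover have "card {e' \<in> E. k e' < k e} \<le> \<rho> e" for e
    unfolding \<rho>_def using assms h_mono by (intro card_mono) auto
  moreover have "\<rho> e < card {e' \<in> E. k e' \<le> k e}" if "e \<in> E" for e
  proof -
    have "k e' \<le> k e" if "h e' < h e" for e'
      using that h_mono[OF \<open>e \<in> E\<close>, of e'] by force
    then show ?thesis
      unfolding \<rho>_def using assms \<open>e \<in> E\<close> by (intro psubset_card_mono) auto
  qed
  ultimately show ?thesis by blast
qed

text \<open>With weights shifted to start at 0, the rank \<open>\<rho> e\<close> is the total of
  \<open>e\<close> and the vertices supply \<open>c e\<close> of it, so the edge needs weight
  \<open>\<rho> e - c e\<close> in \<open>{0..s}\<close>. Here \<open>lower\<close> yields
  \<open>c e \<le> \<rho> e\<close>, and \<open>upper\<close> yields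
  \<open>\<rho> e \<le> c e + s\<close> except for the largest label sum.\<close>

lemma ex_weighting_of_label_counts:
  fixes N s :: nat
  assumes G: "fin_simple_graph V E"
    and N: "N > 0" and f: "\<And>v. v \<in> V \<Longrightarrow> f v \<le> N"
    and card_le: "card E \<le> 3 * s + 1"
    and lower: "\<And>j. j < 2 * N \<Longrightarrow> (j + 1) * s \<le> N * label_count E f j"
    and upper: "\<And>j. j < 2 * N \<Longrightarrow> N * (label_count E f j + 1) \<le> (N + j) * s"
  shows "\<exists>w. edge_irregular_total_weighting V E (Suc s) w"
proof -
  define k where "k e = (\<Sum>v\<in>e. f v)" for e
  define x where "x i = i * s div N" for i
  define c where "c e = (\<Sum>v\<in>e. x (f v))" for e
  have fE: "finite E" using G by (rule fin_simple_graph_finite_edges)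
  obtain \<rho> where inj: "inj_on \<rho> E"
    and \<rho>_ge: "\<And>e. e \<in> E \<Longrightarrow> card {e' \<in> E. k e' < k e} \<le> \<rho> e"
    and \<rho>_less: "\<And>e. e \<in> E \<Longrightarrow> \<rho> e < card {e' \<in> E. k e' \<le> k e}"
    using ex_rank[OF fE, of k] by blast
  have x_le: "N * x i \<le> i * s" for i by (simp add: x_def)
  have x_ge: "i * s < N * x i + N" for i
    using dividend_less_times_div[OF N, of "i * s"] by (simp add: x_def)
  have c_bounds: "c e \<le> \<rho> e \<and> \<rho> e \<le> c e + s" if e: "e \<in> E" for e
  proof -
    obtain u v where uv: "e = {u, v}" "u \<noteq> v" "u \<in> V" "v \<in> V"
      using fin_simple_graph_edgeE[OF G e] .
    have ke: "k e = f u + f v" and ce: "c e = x (f u) + x (f v)"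
      using uv by (simp_all add: k_def c_def)
    have Nc_le: "N * c e \<le> k e * s"
      using x_le[of "f u"] x_le[of "f v"] by (simp add: ke ce algebra_simps)
    have "c e \<le> \<rho> e"
    proof (cases "k e")
      case 0
      then show ?thesis using Nc_le N by simp
    next
      case (Suc j)
      have "j < 2 * N" using Suc ke f[OF uv(3)] f[OF uv(4)] by simp
      \<comment> \<open>All edges of label sum at most \<open>j = k e - 1\<close> precede
        \<open>e\<close>, so their number bounds the rank from below.\<close>
      have "N * c e \<le> (j + 1) * s" using Nc_le Suc by simp
      also have "\<dots> \<le> N * label_count E f j" using lower[OF \<open>j < 2 * N\<close>] .
      also have "label_count E f j \<le> \<rho> e"
        using \<rho>_ge[OF e] by (simp add: label_count_def k_def[symmetric] Suc less_Suc_eq_le)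
      finally show ?thesis using N by simp
    qed
    moreover have "\<rho> e \<le> c e + s"
    proof (cases "k e < 2 * N")
      case True
      \<comment> \<open>The summand 2 pays for rounding: each of the two divisions by
        \<open>N\<close> loses less than \<open>N\<close> after multiplying back.\<close>
      have "N * (\<rho> e + 2) \<le> N * (label_count E f (k e) + 1)"
        using \<rho>_less[OF e] by (intro mult_le_mono2) (simp add: label_count_def k_def[symmetric])
      also have "\<dots> \<le> N * s + f u * s + f v * s" using upper[OF True] by (simp add: ke algebra_simps)
      also have "\<dots> < N * s + (N * x (f u) + N) + (N * x (f v) + N)"
        using x_ge[of "f u"] x_ge[of "f v"] by linarith
      also have "\<dots> = N * (c e + s + 2)" by (simp add: ce algebra_simps)
      finally show ?thesis by (simp only: mult_less_cancel1) simp
    next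
      case False
      \<comment> \<open>At label sum \<open>2 * N\<close> no rounding occurs, and the rank is at
        most \<open>card E - 1\<close>, hence at most \<open>3 * s\<close>.\<close>
      then have "f u = N" "f v = N" using ke f[OF uv(3)] f[OF uv(4)] by simp_all
      then have "c e = 2 * s" using N by (simp add: ce x_def)
      moreover have "card {e' \<in> E. k e' \<le> k e} \<le> card E" using fE by (intro card_mono) auto
      ultimately show ?thesis using \<rho>_less[OF e] card_le by simp
    qed
    ultimately show ?thesis ..
  qed
  \<comment> \<open>Each \<open>Suc\<close> undoes the shift to 0, so totals become
    \<open>\<rho> e + 3\<close>; the truncated subtraction is exact because
    \<open>c e \<le> \<rho> e\<close>.\<close>
  define w where "w = case_sum (\<lambda>v. Suc (x (f v))) (\<lambda>e. Suc (\<rho> e - c e))"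
  have "x (f v) \<le> s" if "v \<in> V" for v
  proof -
    have "N * x (f v) \<le> N * s"
      using x_le[of "f v"] f[OF that] mult_le_mono1[of "f v" N s] by linarith
    then show ?thesis using N by simp
  qed
  moreover have "\<rho> e - c e \<le> s" if "e \<in> E" for e
    using c_bounds[OF that] by linarith
  ultimately have "\<forall>y \<in> V <+> E. w y \<in> {1..Suc s}"
    by (auto simp: w_def)
  moreover have "total_edge_weight w e = \<rho> e + 3" if e: "e \<in> E" for e
  proof -
    obtain u v where uv: "e = {u, v}" "u \<noteq> v" "u \<in> V" "v \<in> V"
      using fin_simple_graph_edgeE[OF G e] .
    then have "(\<Sum>v\<in>e. w (Inl v)) = c e + 2" by (simp add: w_def c_def)
    moreover have "w (Inr e) = Suc (\<rho> e - c e)" by (simp add: w_def)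
    ultimately show ?thesis using c_bounds[OF e] by (simp add: total_edge_weight_def)
  qed
  ultimately have "edge_irregular_total_weighting V E (Suc s) w"
    using inj unfolding edge_irregular_total_weighting_def by (auto dest: inj_onD)
  then show ?thesis by blast
qed

text \<open>Totals are distinct sums of three weights, so they lie in \<open>{3..3 * s}\<close>,
  which offers only \<open>3 * s - 2\<close> values.\<close>

lemma card_edges_le_of_weighting:
  assumes G: "fin_simple_graph V E" and s: "s \<ge> 1"
    and w: "edge_irregular_total_weighting V E s w"
  shows "card E + 2 \<le> 3 * s"
proof -
  have w_range: "w y \<in> {1..s}" if "y \<in> V <+> E" for y
    using w that unfolding edge_irregular_total_weighting_def by blast
  have "total_edge_weight w e \<in> {3..3 * s}" if e: "e \<in> E" for e
  proof -
    obtain u v where "e = {u, v}" "u \<noteq> v" "u \<in> V" "v \<in> V"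
      using fin_simple_graph_edgeE[OF G e] .
    then show ?thesis
      using w_range[of "Inl u"] w_range[of "Inl v"] w_range[of "Inr e"] e
      by (simp add: total_edge_weight_def InlI InrI)
  qed
  moreover have "inj_on (total_edge_weight w) E"
    using w unfolding edge_irregular_total_weighting_def inj_on_def by blast
  ultimately have "card E \<le> card {3..3 * s}"
    by (intro card_inj_on_le) auto
  then show ?thesis using s by simp
qed

section \<open>The label distribution\<close>

text \<open>Uniform labels would fail: label sum 0 would have probability 1/64, below the required
  1/21. The heavy extreme labels raise this to 1/9, and the symmetry under
  \<open>i \<mapsto> 7 - i\<close> matches the lower constraint at \<open>j\<close> with the upper
  one at \<open>13 - j\<close>.\<close>

definition label_prob :: "nat \<Rightarrow> real" where
  "label_prob i = (if i = 0 \<or> i = 7 then 1 / 3 else 1 / 18)"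

text \<open>
  The tolerances must stay below the slack of the expected counts
  (\<open>label_prob_sum_cdf_bounds\<close>), and their inverse squares must sum to less than 8700.
\<close>

definition tolerance :: "nat \<Rightarrow> real" where
  "tolerance j = (if 3 \<le> j \<and> j \<le> 10 then 39 / 1000 else 44 / 1000)"

lemma tolerance_pos: "tolerance j > 0"
  by (simp add: tolerance_def)

lemma atMost_7: "{..7::nat} = {0,1,2,3,4,5,6,7}"
  by auto

lemma random_labelling_label_prob:
  assumes "finite V"
  shows "random_labelling V {..7} label_prob"
  using assms by unfold_locales (auto simp: label_prob_def atMost_7)

text \<open>The two count conditions divided by m, with 21 = 3 * 7 and 1/m replaced by its largest
  value 1/4350. All 14 cases are computed; the tightest are \<open>j = 4\<close> below and
  \<open>j = 9\<close> above, with slack about 0.0397 before the 1/4350 corrections.\<close>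

lemma label_prob_sum_cdf_bounds:
  assumes "finite V" "j < 14"
  defines "\<mu> \<equiv> random_labelling.pair_expect {..7} label_prob (\<lambda>a b. of_bool (a + b \<le> j))"
  shows "\<mu> - tolerance j \<ge> real (j + 1) / 21 * (4351 / 4350)"
    and "\<mu> + tolerance j + 1 / 4350 \<le> real (7 + j) / 21 * (4349 / 4350)"
proof -
  have "j \<in> {0,1,2,3,4,5,6,7,8,9,10,11,12,13}"
    using assms(2) unfolding insert_iff empty_iff by presburger
  then have "\<mu> - tolerance j \<ge> real (j + 1) / 21 * (4351 / 4350) \<and>
    \<mu> + tolerance j + 1 / 4350 \<le> real (7 + j) / 21 * (4349 / 4350)"
    unfolding \<mu>_def random_labelling.pair_expect_def[OF random_labelling_label_prob[OF assms(1)]]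
    by (elim insertE emptyE) (simp_all add: atMost_7 label_prob_def tolerance_def)
  then show "\<mu> - tolerance j \<ge> real (j + 1) / 21 * (4351 / 4350)"
    and "\<mu> + tolerance j + 1 / 4350 \<le> real (7 + j) / 21 * (4349 / 4350)" by auto
qed

section \<open>Existence of an optimal weighting\<close>

lemma ex_weighting:
  assumes G: "fin_simple_graph V E" and m: "m = card E"
    and \<Delta>: "real (max_degree V E) \<le> real m / 4350"
  shows "\<exists>w. edge_irregular_total_weighting V E (Suc ((m + 1) div 3)) w"
proof (cases "E = {}")
  case True
  then have "edge_irregular_total_weighting V E (Suc ((m + 1) div 3)) (\<lambda>_. 1)"
    by (simp add: edge_irregular_total_weighting_def)
  then show ?thesis by blast
next
  case False
  have fV: "finite V" using G by (simp add: fin_simple_graph_def)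
  \<comment> \<open>This is the ceiling of (m - 1)/3, so \<open>Suc s\<close> is the ceiling of (m +
    2)/3.\<close>
  define s where "s = (m + 1) div 3"
  define \<mu> where "\<mu> j = random_labelling.pair_expect {..7} label_prob (\<lambda>a b. of_bool (a + b \<le> j))" for j
  have s_le: "3 * real s \<le> real m + 1" and s_ge: "real m \<le> 3 * real s + 1"
    unfolding s_def by linarith+
  obtain e where e: "e \<in> E" using False by blast
  obtain u v where "e = {u, v}" "u \<noteq> v" "u \<in> V" "v \<in> V"
    using fin_simple_graph_edgeE[OF G e] .
  then have "vertex_degree E u > 0"
    unfolding vertex_degree_def using e fin_simple_graph_finite_edges[OF G] by (auto simp: card_gt_0_iff)
  \<comment> \<open>An edge forces maximum degree at least 1, so the degree hypothesis makes m large
    enough to absorb additive constants.\<close>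
  then have m_ge: "real m \<ge> 4350"
    using vertex_degree_le_max_degree[OF fV \<open>u \<in> V\<close>, of E] \<Delta> by simp
  \<comment> \<open>Eight tolerances 39/1000 and six tolerances 44/1000 give about 8359.\<close>
  have "(\<Sum>j<14. 1 / (tolerance j)\<^sup>2) < 2 * 4350"
    by (simp add: tolerance_def power2_eq_square numeral_eq_Suc lessThan_Suc)
  then have "\<exists>f \<in> V \<rightarrow>\<^sub>E {..7}. \<forall>j<14.
      \<bar>real (label_count E f j) - real m * \<mu> j\<bar> < tolerance j * real m"
    unfolding \<mu>_def m using \<Delta> m
    by (intro ex_concentrated_labelling[OF G False random_labelling_label_prob[OF fV], of 4350])
      (simp_all add: tolerance_pos)
  then obtain f where f: "f \<in> V \<rightarrow>\<^sub>E {..7::nat}"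
    and dev: "\<And>j. j < 14 \<Longrightarrow> \<bar>real (label_count E f j) - real m * \<mu> j\<bar> < tolerance j * real m"
    by blast
  have lower: "(j + 1) * s \<le> 7 * label_count E f j" if j: "j < 2 * 7" for j
  proof -
    \<comment> \<open>The 1 in \<open>3 * s \<le> m + 1\<close> is at most m/4350.\<close>
    have "real (j + 1) / 21 * (real m + 1) \<le> real (j + 1) / 21 * (4351 / 4350) * real m"
      unfolding mult.assoc using m_ge by (intro mult_left_mono) auto
    also have "\<dots> \<le> (\<mu> j - tolerance j) * real m"
      using label_prob_sum_cdf_bounds(1)[OF fV, of j] j unfolding \<mu>_def by (intro mult_right_mono) auto
    also have "\<dots> \<le> real (label_count E f j)"
      using dev[of j] j by (simp add: algebra_simps)
    finally have "real (j + 1) * (real m + 1) \<le> 21 * real (label_count E f j)" by simp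
    moreover have "real (j + 1) * (3 * real s) \<le> real (j + 1) * (real m + 1)"
      using s_le by (intro mult_left_mono) auto
    ultimately have "real ((j + 1) * s) \<le> real (7 * label_count E f j)"
      unfolding of_nat_mult by linarith
    then show ?thesis by (simp only: of_nat_le_iff)
  qed
  have upper: "7 * (label_count E f j + 1) \<le> (7 + j) * s" if j: "j < 2 * 7" for j
  proof -
    \<comment> \<open>Here m/4350 absorbs the extra edge in the count; below it also absorbs the
      loss in \<open>3 * s \<ge> m - 1\<close>.\<close>
    have "real (label_count E f j) + 1 \<le> (\<mu> j + tolerance j + 1 / 4350) * real m"
      using dev[of j] j m_ge by (simp add: algebra_simps)
    also have "\<dots> \<le> real (7 + j) / 21 * (4349 / 4350) * real m"
      using label_prob_sum_cdf_bounds(2)[OF fV, of j] j unfolding \<mu>_def by (intro mult_right_mono) auto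
    also have "\<dots> \<le> real (7 + j) / 21 * (real m - 1)"
      unfolding mult.assoc using m_ge by (intro mult_left_mono) auto
    finally have "21 * (real (label_count E f j) + 1) \<le> real (7 + j) * (real m - 1)" by simp
    moreover have "real (7 + j) * (real m - 1) \<le> real (7 + j) * (3 * real s)"
      using s_ge by (intro mult_left_mono) auto
    ultimately have "real (7 * (label_count E f j + 1)) \<le> real ((7 + j) * s)"
      unfolding of_nat_mult of_nat_add of_nat_1 of_nat_numeral by linarith
    then show ?thesis by (simp only: of_nat_le_iff)
  qed
  have "card E \<le> 3 * s + 1" using s_ge m by linarith
  then show ?thesis
    using ex_weighting_of_label_counts[OF G, of 7 f s] f lower upper unfolding s_def by auto
qed

theorem theorem4:
  fixes V :: "'a set" and E :: "'a set set" and m :: nat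
  assumes "fin_simple_graph V E"
    and "m = card E"
    and "real (max_degree V E) \<le> real m / 4350"
  shows "int (tes V E) = \<lceil>(real m + 2) / 3\<rceil>"
proof -
  define s where "s = Suc ((m + 1) div 3)"
  \<comment> \<open>The two bounds say \<open>s - 1 < (m + 2) / 3 \<le> s\<close>, which identifies
    \<open>s\<close> as the ceiling.\<close>
  have "m + 2 \<le> 3 * s" "3 * s \<le> m + 4"
    unfolding s_def by presburger+
  then have s_ge: "real m + 2 \<le> 3 * real s" and s_le: "3 * real s \<le> real m + 4"
    by linarith+
  have "tes V E = s"
    unfolding tes_def
  proof (rule Least_equality)
    show "s \<ge> 1 \<and> (\<exists>w. edge_irregular_total_weighting V E s w)"
      using ex_weighting[OF assms] by (simp add: s_def)
  next
    fix s' assume "s' \<ge> 1 \<and> (\<exists>w. edge_irregular_total_weighting V E s' w)"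
    then have "m + 2 \<le> 3 * s'"
      using card_edges_le_of_weighting[OF assms(1)] assms(2) by blast
    then show "s \<le> s'" unfolding s_def by linarith
  qed
  moreover have "\<lceil>(real m + 2) / 3\<rceil> = int s"
    using s_ge s_le by (intro ceiling_unique) simp_all
  ultimately show ?thesis by simp
qed

end
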